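(* Let $\mathbb{F}$ be an algebraically closed field with $\mathrm{Char}(\mathbb{F})\neq 2$ and let $d\ge 3$. Let $B,A^*$ be a bipartite Leonard pair over $\mathbb{F}$ with diameter $d$ that has Krawtchouk type, with a parameter array $(\{\theta'_i\}_{i=0}^d;\{\theta^*_i\}_{i=0}^d;\{\varphi'_i\}_{i=1}^d;\{\phi'_i\}_{i=1}^d)$ and corresponding primary data $(\delta',\mu',h',\delta^*,\mu^*,h^*,\tau')$. Assume $B,A^*$ is in normalized TD/D form, that is, the underlying vector space is $\mathbb{F}^{d+1}$, $B$ is the tridiagonal matrix in $\mathrm{Mat}_{d+1}(\mathbb{F})$ with zero diagonal, all subdiagonal entries $1$ and superdiagonal entries $x'_1,\dots,x'_d$, and $A^*=\mathrm{diag}(\theta^*_0,\dots,\theta^*_d)$. Let $H\in\mathrm{Mat}_{d+1}(\mathbb{F})$ be the diagonal matrix with $(i,i)$-entry $2i-d$ for $0\le i\le d$. Let $\delta,\mu,h,\tau\in\mathbb{F}$ satisfy: $\mu\neq0$; $h=0$; $4\tau^2=(\mu^2-\mu'^2)\mu^{*2}$. (Equivalently, $(\delta,\mu,h,\delta^*,\mu^*,h^*,\tau)$ is a primary data of a near-bipartite expansion of $B,A^*$.) Let $A,A^*$ denote the near-bipartite expansion of $B,A^*$ that has primary data $(\delta,\mu,h,\delta^*,\mu^*,h^*,\tau)$. Then $$A=B+(\tau/\mu^* )H+\delta I.$$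
   Context: A tridiagonal matrix is irreducible if all its subdiagonal and superdiagonal entries are nonzero. Let $V$ be a vector space over $\mathbb{F}$ of dimension $d+1$. A Leonard pair on $V$ (with diameter $d$, over $\mathbb{F}$) is an ordered pair $A,A^*$ in $\mathrm{End}(V)$ such that (a) some basis of $V$ makes the matrix of $A$ irreducible tridiagonal and that of $A^*$ diagonal; (b) some basis of $V$ makes the matrix of $A^*$ irreducible tridiagonal and that of $A$ diagonal. ($A^*$ is just a name, not an adjoint.) Matrices act on $\mathbb{F}^{d+1}$ by left multiplication; rows and columns are indexed $0,\dots,d$. Each of $A,A^*$ then has $d+1$ distinct eigenvalues. Flat part: let $E^*_0,\dots,E^*_d$ be the primitive idempotents of $A^*$ (projections onto its eigenspaces along the sum of the other eigenspaces). The flat part of $A$ is $F=\sum_{i=0}^d E^*_i A E^*_i$. $A,A^*$ is bipartite if $F=0$. $A,A^*$ is near-bipartite if $A-F,A^*$ is a Leonard pair on $V$; in that case $A-F,A^*$ is a bipartite Leonard pair called the bipartite contraction of $A,A^*$. A near-bipartite expansion of a bipartite Leonard pair $B,A^*$ on $V$ is a near-bipartite Leonard pair $A,A^*$ on $V$ whose bipartite contraction equals $B,A^*$. Parameter array: an ordering $\{\theta_i\}_{i=0}^d$ of the eigenvalues of $A$ is standard if in some basis $A$ is $\mathrm{diag}(\theta_0,\dots,\theta_d)$ and $A^*$ is irreducible tridiagonal; a standard ordering $\{\theta^*_i\}_{i=0}^d$ of the eigenvalues of $A^*$ is defined with the roles of $A$ and $A^*$ exchanged. Given standard orderings, there are unique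 scalars $\{\varphi_i\}_{i=1}^d$ such that in some basis $A$ is lower bidiagonal with diagonal $\theta_0,\dots,\theta_d$ and all subdiagonal entries $1$, while $A^*$ is upper bidiagonal with diagonal $\theta^*_0,\dots,\theta^*_d$ and superdiagonal $\varphi_1,\dots,\varphi_d$; and unique scalars $\{\phi_i\}_{i=1}^d$ such that in some basis $A$ is lower bidiagonal with diagonal $\theta_d,\theta_{d-1},\dots,\theta_0$ and all subdiagonal entries $1$, while $A^*$ is upper bidiagonal with diagonal $\theta^*_0,\dots,\theta^*_d$ and superdiagonal $\phi_1,\dots,\phi_d$. The sequence $(\{\theta_i\};\{\theta^*_i\};\{\varphi_i\};\{\phi_i\})$ is a parameter array of $A,A^*$. Type II: for $d\ge 3$ it is known that $\frac{\theta_{i-2}-\theta_{i+1}}{\theta_{i-1}-\theta_i}$ and $\frac{\theta^*_{i-2}-\theta^*_{i+1}}{\theta^*_{i-1}-\theta^*_i}$ are equal and independent of $i$ for $2\le i\le d-1$; their common value is written $\beta+1$. $A,A^*$ has type II if $\beta=2$. It is known that a parameter array of type II has the form $\theta_i=\delta+\mu(i-d/2)+hi(d-i)$, $\theta^*_i=\delta^*+\mu^*(i-d/2)+h^*i(d-i)$ $(0\le i\le d)$, $\varphi_i=i(d-i+1)\big(\tau-\mu\mu^*/2+(h\mu^*+\mu h^* )(i-(d+1)/2)+hh^*(i-1)(d-i)\big)$, $\phi_i=i(d-i+1)\big(\tau+\mu\mu^*/2+(h\mu^*-\mu h^* )(i-(d+1)/2)+hh^*(i-1)(d-i)\big)$ $(1\le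 i\le d)$ for a unique sequence $(\delta,\mu,h,\delta^*,\mu^*,h^*,\tau)$ of scalars in $\mathbb{F}$, called the primary data corresponding to the parameter array. A primary data of a type II Leonard pair $A,A^*$ is the primary data corresponding to some parameter array of $A,A^*$. $A,A^*$ has Krawtchouk type if it has type II and both $\theta_i-\theta_{i-1}$ and $\theta^*_i-\theta^*_{i-1}$ are independent of $i$ for $1\le i\le d$ (then $h=h^*=0$ and $\mu,\mu^*\neq0$). *)

theory Defs
  imports
    "HOL-Computational_Algebra.Computational_Algebra"
    "Jordan_Normal_Form.Char_Poly"
begin

text \<open>
  The underlying vector space is the space of column vectors of length \<open>d + 1\<close>, and its
  endomorphisms are the square matrices of size \<open>d + 1\<close>, with rows and columns indexed by
  \<open>0, \<dots>, d\<close>. If \<^term>\<open>similar_mat_wit A M P Q\<close> holds, then the columns of \<^term>\<open>P\<close> form a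
  basis, \<^term>\<open>Q\<close> is the inverse of \<^term>\<open>P\<close>, and \<^term>\<open>M\<close> is the matrix that represents
  \<^term>\<open>A\<close> with respect to this basis.
\<close>

definition tridiagonal :: "'a::zero mat \<Rightarrow> bool" where
  "tridiagonal M \<longleftrightarrow> (\<forall>i<dim_row M. \<forall>j<dim_col M.
     i \<noteq> j \<and> i \<noteq> Suc j \<and> j \<noteq> Suc i \<longrightarrow> M $$ (i, j) = 0)"

definition irreducible_tridiagonal :: "'a::zero mat \<Rightarrow> bool" where
  "irreducible_tridiagonal M \<longleftrightarrow> tridiagonal M \<and>
     (\<forall>i<dim_row M. \<forall>j<dim_col M. i = Suc j \<or> j = Suc i \<longrightarrow> M $$ (i, j) \<noteq> 0)"

definition leonard_pair :: "nat \<Rightarrow> 'a::field mat \<Rightarrow> 'a mat \<Rightarrow> bool" where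
  "leonard_pair d A As \<longleftrightarrow>
     A \<in> carrier_mat (d + 1) (d + 1) \<and> As \<in> carrier_mat (d + 1) (d + 1) \<and>
     (\<exists>P Q M D. similar_mat_wit A M P Q \<and> similar_mat_wit As D P Q \<and>
        irreducible_tridiagonal M \<and> diagonal_mat D) \<and>
     (\<exists>P Q M D. similar_mat_wit As M P Q \<and> similar_mat_wit A D P Q \<and>
        irreducible_tridiagonal M \<and> diagonal_mat D)"

text \<open>
  The projection onto the eigenspace of \<^term>\<open>As\<close> for \<^term>\<open>t\<close> along the sum of the other
  eigenspaces. It is meaningful only if \<^term>\<open>As\<close> is diagonalizable, in which case the
  eigenspaces span and the described matrix exists and is unique.
\<close>

definition primitive_idempotent :: "'a::field mat \<Rightarrow> 'a \<Rightarrow> 'a mat" where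
  "primitive_idempotent As t = (THE E.
     E \<in> carrier_mat (dim_row As) (dim_row As) \<and>
     (\<forall>v. eigenvector As v t \<longrightarrow> E *\<^sub>v v = v) \<and>
     (\<forall>v s. s \<noteq> t \<and> eigenvector As v s \<longrightarrow> E *\<^sub>v v = 0\<^sub>v (dim_row As)))"

text \<open>
  The sum of the matrices \<open>E A E\<close>, where \<open>E\<close> runs over the primitive idempotents of
  \<^term>\<open>As\<close>. The sum is taken entrywise, because the type of matrices of all sizes is not
  an additive monoid.
\<close>

definition flat_part :: "'a::field mat \<Rightarrow> 'a mat \<Rightarrow> 'a mat" where
  "flat_part A As = mat (dim_row A) (dim_col A) (\<lambda>(i, j).
     \<Sum>t\<in>{t. eigenvalue As t}.
       (primitive_idempotent As t * A * primitive_idempotent As t) $$ (i, j))"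

definition bipartite :: "nat \<Rightarrow> 'a::field mat \<Rightarrow> 'a mat \<Rightarrow> bool" where
  "bipartite d A As \<longleftrightarrow>
     leonard_pair d A As \<and> flat_part A As = 0\<^sub>m (d + 1) (d + 1)"

definition near_bipartite :: "nat \<Rightarrow> 'a::field mat \<Rightarrow> 'a mat \<Rightarrow> bool" where
  "near_bipartite d A As \<longleftrightarrow>
     leonard_pair d A As \<and> leonard_pair d (A - flat_part A As) As"

definition near_bipartite_expansion :: "nat \<Rightarrow> 'a::field mat \<Rightarrow> 'a mat \<Rightarrow> 'a mat \<Rightarrow> bool" where
  "near_bipartite_expansion d B As A \<longleftrightarrow>
     bipartite d B As \<and> near_bipartite d A As \<and> A - flat_part A As = B"

text \<open>
  A standard ordering of the eigenvalues of the first matrix of the pair. For the second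
  matrix, use the definition with the two arguments exchanged.
\<close>

definition standard_ordering :: "nat \<Rightarrow> 'a::field mat \<Rightarrow> 'a mat \<Rightarrow> (nat \<Rightarrow> 'a) \<Rightarrow> bool" where
  "standard_ordering d A As \<theta> \<longleftrightarrow>
     bij_betw \<theta> {0..d} {t. eigenvalue A t} \<and>
     (\<exists>P Q M. similar_mat_wit A (mat_diag (d + 1) \<theta>) P Q \<and>
        similar_mat_wit As M P Q \<and> irreducible_tridiagonal M)"

definition lower_bidiagonal :: "nat \<Rightarrow> (nat \<Rightarrow> 'a::field) \<Rightarrow> 'a mat" where
  "lower_bidiagonal d \<theta> = mat (d + 1) (d + 1) (\<lambda>(i, j).
     if i = j then \<theta> i else if i = Suc j then 1 else 0)"

text \<open>
  The superdiagonal is indexed by \<open>1, \<dots>, d\<close>: its entry in row \<open>i - 1\<close> and column \<open>i\<close>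
  is \<^term>\<open>\<phi> i\<close>.
\<close>

definition upper_bidiagonal :: "nat \<Rightarrow> (nat \<Rightarrow> 'a::field) \<Rightarrow> (nat \<Rightarrow> 'a) \<Rightarrow> 'a mat" where
  "upper_bidiagonal d \<theta> \<phi> = mat (d + 1) (d + 1) (\<lambda>(i, j).
     if i = j then \<theta> i else if j = Suc i then \<phi> j else 0)"

text \<open>
  The sequences \<^term>\<open>\<phi>1\<close> and \<^term>\<open>\<phi>2\<close> are the first and the second split sequence,
  often written \<open>\<phi>\<close> in its two typographic variants. Only their values at \<open>1, \<dots>, d\<close>
  matter.
\<close>

definition parameter_array ::
  "nat \<Rightarrow> 'a::field mat \<Rightarrow> 'a mat \<Rightarrow>
   (nat \<Rightarrow> 'a) \<Rightarrow> (nat \<Rightarrow> 'a) \<Rightarrow> (nat \<Rightarrow> 'a) \<Rightarrow> (nat \<Rightarrow> 'a) \<Rightarrow> bool" where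
  "parameter_array d A As \<theta> \<theta>s \<phi>1 \<phi>2 \<longleftrightarrow>
     leonard_pair d A As \<and> standard_ordering d A As \<theta> \<and> standard_ordering d As A \<theta>s \<and>
     (\<exists>P Q. similar_mat_wit A (lower_bidiagonal d \<theta>) P Q \<and>
        similar_mat_wit As (upper_bidiagonal d \<theta>s \<phi>1) P Q) \<and>
     (\<exists>P Q. similar_mat_wit A (lower_bidiagonal d (\<lambda>i. \<theta> (d - i))) P Q \<and>
        similar_mat_wit As (upper_bidiagonal d \<theta>s \<phi>2) P Q)"

text \<open>
  The scalar \<^term>\<open>\<beta>\<close> is one less than the common value of the two families of quotients.
  A standard ordering of the eigenvalues is unique up to reversal, and reversal only
  permutes the quotients, so it does not matter which standard orderings are used. For the
  same reason it is immaterial in \<open>krawtchouk_type\<close> that all standard orderings are used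
  (standard orderings of both kinds exist for every Leonard pair).
\<close>

definition fundamental_parameter :: "nat \<Rightarrow> 'a::field mat \<Rightarrow> 'a mat \<Rightarrow> 'a \<Rightarrow> bool" where
  "fundamental_parameter d A As \<beta> \<longleftrightarrow>
     (\<exists>\<theta> \<theta>s. standard_ordering d A As \<theta> \<and> standard_ordering d As A \<theta>s \<and>
        (\<forall>i\<in>{2..d - 1}.
           (\<theta> (i - 2) - \<theta> (i + 1)) / (\<theta> (i - 1) - \<theta> i) = \<beta> + 1 \<and>
           (\<theta>s (i - 2) - \<theta>s (i + 1)) / (\<theta>s (i - 1) - \<theta>s i) = \<beta> + 1))"

definition type_II :: "nat \<Rightarrow> 'a::field mat \<Rightarrow> 'a mat \<Rightarrow> bool" where
  "type_II d A As \<longleftrightarrow> d \<ge> 3 \<and> leonard_pair d A As \<and> fundamental_parameter d A As 2"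

definition krawtchouk_type :: "nat \<Rightarrow> 'a::field mat \<Rightarrow> 'a mat \<Rightarrow> bool" where
  "krawtchouk_type d A As \<longleftrightarrow> type_II d A As \<and>
     (\<forall>\<theta> \<theta>s. standard_ordering d A As \<theta> \<and> standard_ordering d As A \<theta>s \<longrightarrow>
        (\<exists>c. \<forall>i\<in>{1..d}. \<theta> i - \<theta> (i - 1) = c) \<and>
        (\<exists>c. \<forall>i\<in>{1..d}. \<theta>s i - \<theta>s (i - 1) = c))"

text \<open>
  The primary data are listed in the order
  \<open>\<delta>, \<mu>, h, \<delta>\<^sup>*, \<mu>\<^sup>*, h\<^sup>*, \<tau>\<close>; the suffix \<open>s\<close> of a name stands for the star.
\<close>

definition corresponding_primary_data ::
  "nat \<Rightarrow> (nat \<Rightarrow> 'a::field) \<Rightarrow> (nat \<Rightarrow> 'a) \<Rightarrow> (nat \<Rightarrow> 'a) \<Rightarrow> (nat \<Rightarrow> 'a) \<Rightarrow>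
   'a \<Rightarrow> 'a \<Rightarrow> 'a \<Rightarrow> 'a \<Rightarrow> 'a \<Rightarrow> 'a \<Rightarrow> 'a \<Rightarrow> bool" where
  "corresponding_primary_data d \<theta> \<theta>s \<phi>1 \<phi>2 \<delta> \<mu> h \<delta>s \<mu>s hs \<tau> \<longleftrightarrow>
     (\<forall>i\<in>{0..d}.
        \<theta> i = \<delta> + \<mu> * (of_nat i - of_nat d / 2) + h * of_nat i * of_nat (d - i) \<and>
        \<theta>s i = \<delta>s + \<mu>s * (of_nat i - of_nat d / 2) + hs * of_nat i * of_nat (d - i)) \<and>
     (\<forall>i\<in>{1..d}.
        \<phi>1 i = of_nat i * of_nat (d - i + 1) *
          (\<tau> - \<mu> * \<mu>s / 2 + (h * \<mu>s + \<mu> * hs) * (of_nat i - of_nat (d + 1) / 2)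
             + h * hs * of_nat (i - 1) * of_nat (d - i)) \<and>
        \<phi>2 i = of_nat i * of_nat (d - i + 1) *
          (\<tau> + \<mu> * \<mu>s / 2 + (h * \<mu>s - \<mu> * hs) * (of_nat i - of_nat (d + 1) / 2)
             + h * hs * of_nat (i - 1) * of_nat (d - i)))"

definition primary_data ::
  "nat \<Rightarrow> 'a::field mat \<Rightarrow> 'a mat \<Rightarrow>
   'a \<Rightarrow> 'a \<Rightarrow> 'a \<Rightarrow> 'a \<Rightarrow> 'a \<Rightarrow> 'a \<Rightarrow> 'a \<Rightarrow> bool" where
  "primary_data d A As \<delta> \<mu> h \<delta>s \<mu>s hs \<tau> \<longleftrightarrow> type_II d A As \<and>
     (\<exists>\<theta> \<theta>s \<phi>1 \<phi>2. parameter_array d A As \<theta> \<theta>s \<phi>1 \<phi>2 \<and>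
        corresponding_primary_data d \<theta> \<theta>s \<phi>1 \<phi>2 \<delta> \<mu> h \<delta>s \<mu>s hs \<tau>)"

definition normalized_TD_D_form ::
  "nat \<Rightarrow> 'a::field mat \<Rightarrow> 'a mat \<Rightarrow> (nat \<Rightarrow> 'a) \<Rightarrow> (nat \<Rightarrow> 'a) \<Rightarrow> bool" where
  "normalized_TD_D_form d B As x \<theta>s \<longleftrightarrow>
     B = mat (d + 1) (d + 1) (\<lambda>(i, j).
       if i = Suc j then 1 else if j = Suc i then x j else 0) \<and>
     As = mat_diag (d + 1) \<theta>s"

end

theory Submission
  imports Defs
begin

text \<open>
  Let \<open>F\<close> be the matrix with all subdiagonal entries \<open>1\<close>, let \<open>E\<close> be the matrix with superdiagonal
  entries \<open>j (d - j + 1)\<close>, and let \<open>H = diag(2i - d)\<close>. They span a copy of the Lie algebra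
  \<open>sl\<^sub>2\<close>, and every matrix that occurs for a Leonard pair of Krawtchouk type is of the form
  \<open>a F + b E + e H + c I\<close>: the diagonal forms, the bidiagonal split forms, and the normalized TD/D
  form. Conjugation by \<open>exp(t E)\<close> acts by
  \<open>(a, b, e) \<mapsto> (a, b - 2te - t\<^sup>2a, e + ta)\<close>, and a weighted reversal of the basis acts by
  \<open>(a, b, e) \<mapsto> (b, a, -e)\<close>. A single exponential carries the TD/D form with
  \<open>(a, b, e) = (1, \<mu>\<^sup>2/4 - (\<tau>/\<mu>\<^sup>*)\<^sup>2, \<tau>/\<mu>\<^sup>*)\<close> to the split form with primary data
  \<open>(\<delta>, \<mu>, 0, \<delta>\<^sup>*, \<mu>\<^sup>*, 0, \<tau>)\<close>. Since the normalized TD/D form is unique, this determines both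
  \<open>B\<close> (where the zero diagonal forces \<open>\<tau>' = \<delta>' = 0\<close>) and \<open>A\<close>, and the condition on \<open>\<tau>\<close> says
  that their off-diagonal parts agree.
\<close>

section \<open>The span of E, F, H and I, and its products with other matrices\<close>

definition sl2_mat :: "nat \<Rightarrow> 'a::comm_ring_1 \<Rightarrow> 'a \<Rightarrow> 'a \<Rightarrow> 'a \<Rightarrow> 'a mat" where
  "sl2_mat d a b e c = mat (d + 1) (d + 1) (\<lambda>(i, j).
     if i = j then c + e * (2 * of_nat i - of_nat d)
     else if i = Suc j then a
     else if j = Suc i then b * (of_nat j * (of_nat d - of_nat i)) else 0)"

lemma sl2_mat_carrier [simp]: "sl2_mat d a b e c \<in> carrier_mat (d + 1) (d + 1)"
  by (simp add: sl2_mat_def)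

lemma sl2_mat_dim [simp]:
  "dim_row (sl2_mat d a b e c) = d + 1" "dim_col (sl2_mat d a b e c) = d + 1"
  by (simp_all add: sl2_mat_def)

lemma sl2_mat_diag: "sl2_mat d 0 0 e c = mat_diag (d + 1) (\<lambda>i. c + e * (2 * of_nat i - of_nat d))"
  by (rule eq_matI) (auto simp: sl2_mat_def mat_diag_def)

lemma sl2_mat_times_index:
  fixes P :: "'a::comm_ring_1 mat"
  assumes P: "P \<in> carrier_mat (d + 1) n" and i: "i \<le> d" and j: "j < n"
  shows "(sl2_mat d a b e c * P) $$ (i, j) =
    (case i of 0 \<Rightarrow> 0 | Suc k \<Rightarrow> a * P $$ (k, j)) + (c + e * (2 * of_nat i - of_nat d)) * P $$ (i, j)
      + (if i < d then b * (of_nat (Suc i) * (of_nat d - of_nat i)) * P $$ (Suc i, j) else 0)"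
    (is "_ = ?R")
proof -
  have "(sl2_mat d a b e c * P) $$ (i, j) = (\<Sum>k<Suc d. sl2_mat d a b e c $$ (i, k) * P $$ (k, j))"
    using P i j by (simp add: scalar_prod_def lessThan_atLeast0)
  \<comment> \<open>A tridiagonal row meets only \<open>k = i - 1\<close>, \<open>i\<close> and
    \<open>i + 1\<close>. Each indicator sum disappears when its neighbour lies outside the index
    range, which produces the guards at \<open>i = 0\<close> and \<open>i = d\<close>.\<close>
  also have "\<dots> = (\<Sum>k<Suc d. (if Suc k = i then a * P $$ (k, j) else 0)
      + (if k = i then (c + e * (2 * of_nat i - of_nat d)) * P $$ (i, j) else 0)
      + (if k = Suc i then b * (of_nat (Suc i) * (of_nat d - of_nat i)) * P $$ (Suc i, j) else 0))"
    using i by (intro sum.cong) (auto simp: sl2_mat_def)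
  also have "\<dots> = ?R"
    using i by (cases i) (simp_all add: sum.distrib del: sum.lessThan_Suc)
  finally show ?thesis .
qed

lemma times_sl2_mat_index:
  fixes P :: "'a::comm_ring_1 mat"
  assumes P: "P \<in> carrier_mat n (d + 1)" and i: "i < n" and j: "j \<le> d"
  shows "(P * sl2_mat d a b e c) $$ (i, j) =
    (if j < d then P $$ (i, Suc j) * a else 0) + P $$ (i, j) * (c + e * (2 * of_nat j - of_nat d))
      + (case j of 0 \<Rightarrow> 0 | Suc k \<Rightarrow> P $$ (i, k) * (b * (of_nat j * (of_nat d - of_nat k))))"
    (is "_ = ?R")
proof -
  have "(P * sl2_mat d a b e c) $$ (i, j) = (\<Sum>k<Suc d. P $$ (i, k) * sl2_mat d a b e c $$ (k, j))"
    using P i j by (simp add: scalar_prod_def lessThan_atLeast0)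
  also have "\<dots> = (\<Sum>k<Suc d. (if k = Suc j then P $$ (i, k) * a else 0)
      + (if k = j then P $$ (i, j) * (c + e * (2 * of_nat j - of_nat d)) else 0)
      + (if Suc k = j then P $$ (i, k) * (b * (of_nat j * (of_nat d - of_nat k))) else 0))"
    using j by (intro sum.cong) (auto simp: sl2_mat_def)
  also have "\<dots> = ?R"
    using j by (cases j) (simp_all add: sum.distrib del: sum.lessThan_Suc)
  finally show ?thesis .
qed

text \<open>The entries of the exponential of \<open>t E\<close>, where \<open>E\<close> is \<open>sl2_mat d 0 1 0 0\<close>; the factorial
  denominators of the exponential series are absorbed in the binomial coefficients.\<close>

definition exp_entry :: "nat \<Rightarrow> 'a::comm_ring_1 \<Rightarrow> nat \<Rightarrow> nat \<Rightarrow> 'a" where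
  "exp_entry d t i j = t ^ (j - i) * of_nat (j choose i) * (\<Prod>k = i..<j. of_nat d - of_nat k)"

section \<open>Commutation of exp(tE) with E, F and H, entry by entry\<close>

lemma exp_entry_below [simp]: "j < i \<Longrightarrow> exp_entry d t i j = 0"
  by (simp add: exp_entry_def binomial_eq_0)

lemma exp_entry_diag [simp]: "exp_entry d t i i = 1"
  by (simp add: exp_entry_def)

lemma exp_entry_beyond: "i \<le> d \<Longrightarrow> exp_entry d t i (Suc d) = 0"
  by (simp add: exp_entry_def)

text \<open>The \<open>(i, Suc j)\<close> entry of [H, exp(tE)] = -2t exp(tE) E, with the factor -2
  removed. It comes down to absorption in a binomial coefficient.\<close>

lemma exp_entry_weight:
  "(of_nat (Suc j) - of_nat i) * exp_entry d t i (Suc j) =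
     t * (of_nat (Suc j) * (of_nat d - of_nat j) * exp_entry d t i j)"
proof (cases "i \<le> j")
  case True
  define c where "c = t ^ (j - i) * (\<Prod>k = i..<j. of_nat d - of_nat k)"
  have "(Suc j - i) * (Suc j choose i) = Suc j * (j choose i)"
    using True binomial_absorb_comp[of "Suc j" i] by simp
  then have absorb: "(of_nat (Suc j) - of_nat i) * of_nat (Suc j choose i) = of_nat (Suc j) * (of_nat (j choose i) :: 'a)"
    using True by (metis le_SucI of_nat_diff of_nat_mult)
  have "exp_entry d t i (Suc j) = t * c * of_nat (Suc j choose i) * (of_nat d - of_nat j)"
    using True by (simp add: exp_entry_def c_def Suc_diff_le mult_ac del: binomial_Suc_Suc)
  then have "(of_nat (Suc j) - of_nat i) * exp_entry d t i (Suc j) =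
      t * c * (of_nat d - of_nat j) * ((of_nat (Suc j) - of_nat i) * of_nat (Suc j choose i))"
    by (simp only: mult_ac)
  also have "\<dots> = t * (of_nat (Suc j) * (of_nat d - of_nat j) * (c * of_nat (j choose i)))"
    unfolding absorb by (simp only: mult_ac)
  also have "c * of_nat (j choose i) = exp_entry d t i j"
    by (simp add: exp_entry_def c_def mult_ac)
  finally show ?thesis .
qed (cases "i = Suc j"; simp)

text \<open>The \<open>(i, Suc j)\<close> entry of E exp(tE) = exp(tE) E.\<close>

lemma exp_entry_raise:
  "of_nat (Suc i) * (of_nat d - of_nat i) * exp_entry d t (Suc i) (Suc j) =
     of_nat (Suc j) * (of_nat d - of_nat j) * exp_entry d t i j"
proof (cases "i \<le> j")
  case True
  have absorb: "of_nat (Suc i) * of_nat (Suc j choose Suc i) = of_nat (Suc j) * (of_nat (j choose i) :: 'a)"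
    by (metis Suc_times_binomial of_nat_mult)
  have shift: "(of_nat d - of_nat i) * (\<Prod>k = Suc i..<Suc j. of_nat d - of_nat k :: 'a) =
      (of_nat d - of_nat j) * (\<Prod>k = i..<j. of_nat d - of_nat k)"
    using True prod.atLeast_Suc_lessThan[of i "Suc j" "\<lambda>k. of_nat d - of_nat k :: 'a"]
    by (simp add: mult.commute)
  have "of_nat (Suc i) * (of_nat d - of_nat i) * exp_entry d t (Suc i) (Suc j) =
      t ^ (j - i) * (of_nat (Suc i) * of_nat (Suc j choose Suc i)) *
      ((of_nat d - of_nat i) * (\<Prod>k = Suc i..<Suc j. of_nat d - of_nat k))"
    unfolding exp_entry_def diff_Suc_Suc by (simp only: mult_ac)
  also have "\<dots> = of_nat (Suc j) * (of_nat d - of_nat j) * exp_entry d t i j"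
    unfolding absorb shift exp_entry_def by (simp only: mult_ac)
  finally show ?thesis .
qed simp

text \<open>The \<open>(Suc i, j)\<close> entry of [F, exp(tE)] = (t/2)(H exp(tE) + exp(tE) H). Row
  0, where F exp(tE) vanishes, is treated in \<open>exp_entry_lower_0\<close>.\<close>

lemma exp_entry_lower:
  "exp_entry d t (Suc i) (Suc j) + t * (of_nat (Suc i) + of_nat j - of_nat d) * exp_entry d t (Suc i) j =
     exp_entry d t i j"
proof (cases "Suc i \<le> j")
  case True
  define c where "c = t ^ (j - Suc i) * (\<Prod>k = Suc i..<j. of_nat d - of_nat k)"
  have diff: "j - i = Suc (j - Suc i)" using True by simp
  have "Suc i * (j choose Suc i) = (j - i) * (j choose i)"
    using True by (metis Suc_le_D binomial_absorb_comp binomial_absorption diff_Suc_1)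
  then have absorb: "of_nat (Suc i) * of_nat (j choose Suc i) = (of_nat j - of_nat i) * (of_nat (j choose i) :: 'a)"
    using True by (metis Suc_leD of_nat_diff of_nat_mult)
  have "exp_entry d t (Suc i) (Suc j) = t * c * of_nat (Suc j choose Suc i) * (of_nat d - of_nat j)"
    using True by (simp add: exp_entry_def c_def diff mult_ac del: binomial_Suc_Suc)
  then have "exp_entry d t (Suc i) (Suc j) =
      t * c * (of_nat (j choose i) + of_nat (j choose Suc i)) * (of_nat d - of_nat j)"
    by simp
  moreover have "exp_entry d t i j = t * c * of_nat (j choose i) * (of_nat d - of_nat i)"
    using True by (simp add: exp_entry_def c_def diff prod.atLeast_Suc_lessThan mult_ac)
  moreover have "exp_entry d t (Suc i) j = c * of_nat (j choose Suc i)"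
    by (simp add: exp_entry_def c_def mult_ac)
  \<comment> \<open>After Pascal's rule only a multiple of the absorption identity
    \<open>absorb\<close> is left.\<close>
  ultimately have "exp_entry d t (Suc i) (Suc j)
      + t * (of_nat (Suc i) + of_nat j - of_nat d) * exp_entry d t (Suc i) j - exp_entry d t i j =
      t * c * (of_nat (Suc i) * of_nat (j choose Suc i) - (of_nat j - of_nat i) * of_nat (j choose i))"
    by (simp add: algebra_simps)
  then show ?thesis by (simp only: absorb) simp
qed (cases "i = j"; simp)

lemma exp_entry_lower_0:
  "exp_entry d t 0 (Suc j) + t * (of_nat j - of_nat d) * exp_entry d t 0 j = 0"
  by (simp add: exp_entry_def algebra_simps)

section \<open>Conjugation by exp(tE) and by the weighted reversal\<close>

lemma similar_mat_wit_of_intertwining: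
  fixes M N P Q :: "'a::semiring_1 mat"
  assumes "P * Q = 1\<^sub>m n" "Q * P = 1\<^sub>m n" "M * P = P * N"
    and "M \<in> carrier_mat n n" "N \<in> carrier_mat n n" "P \<in> carrier_mat n n" "Q \<in> carrier_mat n n"
  shows "similar_mat_wit M N P Q"
proof (rule similar_mat_witI)
  have "M = M * (P * Q)" using assms by simp
  also have "\<dots> = M * P * Q" using assms(4,6,7) by (simp add: assoc_mult_mat)
  finally show "M = P * N * Q" unfolding assms(3) .
qed (use assms in auto)

text \<open>The entrywise commutation relations combine to an intertwining relation. A single pair
  \<open>P\<close>, \<open>Q\<close> serves all coefficients, so that both matrices of a Leonard
  pair can be moved to the same new basis.\<close>

lemma sl2_mat_exp_conjugation:
  fixes t :: "'a::field"
  obtains P Q where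
    "\<And>a b e c. similar_mat_wit (sl2_mat d a b e c) (sl2_mat d a (b - 2 * t * e - t\<^sup>2 * a) (e + t * a) c) P Q"
proof -
  define P where "P = mat (d + 1) (d + 1) (\<lambda>(i, j). exp_entry d t i j)"
  have P: "P \<in> carrier_mat (d + 1) (d + 1)" by (simp add: P_def)
  have "det P = prod_list (diag_mat P)"
    by (rule det_upper_triangular[OF _ P]) (auto simp: P_def)
  also have "diag_mat P = map (\<lambda>_. 1) [0..<d + 1]"
    by (auto simp: diag_mat_def P_def simp del: upt_Suc)
  also have "prod_list \<dots> = (1 :: 'a)"
    by (induction d) simp_all
  finally have "det P \<noteq> 0" by simp
  from det_non_zero_imp_unit[OF P this] obtain Q where
    Q: "Q \<in> carrier_mat (d + 1) (d + 1)" "P * Q = 1\<^sub>m (d + 1)" "Q * P = 1\<^sub>m (d + 1)"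
    unfolding Units_def ring_mat_def by auto
  have "similar_mat_wit (sl2_mat d a b e c) (sl2_mat d a (b - 2 * t * e - t\<^sup>2 * a) (e + t * a) c) P Q" for a b e c
  proof (rule similar_mat_wit_of_intertwining[OF Q(2,3) _ _ _ P Q(1)])
    show "sl2_mat d a b e c * P = P * sl2_mat d a (b - 2 * t * e - t\<^sup>2 * a) (e + t * a) c" (is "?L = ?R")
    proof (rule eq_matI)
      fix i j assume "i < dim_row ?R" "j < dim_col ?R"
      then have ij: "i \<le> d" "j \<le> d" by (auto simp: P_def)
      define p where "p = exp_entry d t i j"
      \<comment> \<open>\<open>X\<close> is the entry of \<open>P\<close> times E and, by
        commutation, of E times \<open>P\<close>. The facts \<open>E\<close>, \<open>H\<close> and
        \<open>F\<close> express all products through \<open>p\<close>, \<open>X\<close> and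
        \<open>exp_entry d t i (Suc j)\<close>.\<close>
      define X where "X = (case j of 0 \<Rightarrow> 0 | Suc k \<Rightarrow> of_nat j * (of_nat d - of_nat k) * exp_entry d t i k)"
      have E: "of_nat (Suc i) * (of_nat d - of_nat i) * exp_entry d t (Suc i) j = X"
        by (cases j) (simp_all only: X_def exp_entry_raise, simp_all)
      have H: "(of_nat j - of_nat i) * p = t * X"
        by (cases j) (simp_all only: X_def p_def exp_entry_weight nat.case, cases i, simp_all)
      have F: "(case i of 0 \<Rightarrow> 0 | Suc k \<Rightarrow> exp_entry d t k j) =
          exp_entry d t i (Suc j) + t * (of_nat i + of_nat j - of_nat d) * p"
        by (cases i) (simp_all only: p_def exp_entry_lower exp_entry_lower_0 nat.case of_nat_0 add_0)
      have L: "?L $$ (i, j) = a * (case i of 0 \<Rightarrow> 0 | Suc k \<Rightarrow> exp_entry d t k j)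
          + (c + e * (2 * of_nat i - of_nat d)) * p + b * X"
        using ij unfolding E[symmetric]
        by (subst sl2_mat_times_index[OF P]) (auto simp: P_def p_def split: nat.split)
      \<comment> \<open>For \<open>j = d\<close> the product of \<open>P\<close> with F has no term,
        in agreement with \<open>exp_entry_beyond\<close>.\<close>
      have R: "?R $$ (i, j) = a * exp_entry d t i (Suc j)
          + (c + (e + t * a) * (2 * of_nat j - of_nat d)) * p + (b - 2 * t * e - t\<^sup>2 * a) * X"
        using ij exp_entry_beyond[of i d t] unfolding X_def
        by (subst times_sl2_mat_index[OF P]) (auto simp: P_def p_def mult_ac not_less split: nat.split)
      \<comment> \<open>The lowering relation \<open>F\<close> enters here; the remainder vanishes
        by the weight relation \<open>H\<close>.\<close>
      have "?L $$ (i, j) - ?R $$ (i, j) =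
          (2 * t * e + t\<^sup>2 * a) * X - (2 * e + t * a) * ((of_nat j - of_nat i) * p)"
        unfolding L R F by (simp add: algebra_simps power2_eq_square)
      then show "?L $$ (i, j) = ?R $$ (i, j)"
        unfolding H by (simp add: algebra_simps power2_eq_square)
    qed (auto simp: P_def)
  qed (rule sl2_mat_carrier)+
  then show thesis by (rule that)
qed

text \<open>Reversing the basis interchanges raising and lowering and negates H. The weights absorb
  the superdiagonal factors of E and are invertible by the nonvanishing assumption.\<close>

lemma sl2_mat_swap_conjugation:
  assumes "\<And>i. 1 \<le> i \<Longrightarrow> i \<le> d \<Longrightarrow> of_nat i \<noteq> (0 :: 'a::field)"
  obtains P Q where
    "\<And>a b e c :: 'a. similar_mat_wit (sl2_mat d a b e c) (sl2_mat d b a (- e) c) P Q"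
proof -
  \<comment> \<open>With this weight, column \<open>j\<close> of \<open>P\<close> is the
    \<open>j\<close>-th power of E applied to the last unit vector.\<close>
  define w :: "nat \<Rightarrow> 'a" where "w j = (\<Prod>k<j. of_nat (Suc k) * (of_nat d - of_nat k))" for j
  define P where "P = mat (d + 1) (d + 1) (\<lambda>(i, j). if i + j = d then w j else 0)"
  define Q where "Q = mat (d + 1) (d + 1) (\<lambda>(i, j). if i + j = d then inverse (w i) else 0)"
  have w_nz: "w j \<noteq> 0" if "j \<le> d" for j
  proof -
    have "of_nat (Suc k) * (of_nat d - of_nat k) \<noteq> (0 :: 'a)" if "k < d" for k
      using assms[of "Suc k"] assms[of "d - k"] that by (simp add: of_nat_diff)
    then show ?thesis using that by (auto simp: w_def)
  qed
  have w_Suc: "w (Suc j) = w j * (of_nat (Suc j) * (of_nat d - of_nat j))" for j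
    by (simp add: w_def)
  have P: "P \<in> carrier_mat (d + 1) (d + 1)" by (simp add: P_def)
  have Q: "Q \<in> carrier_mat (d + 1) (d + 1)" by (simp add: Q_def)
  have QP: "Q * P = 1\<^sub>m (d + 1)"
  proof (rule eq_matI)
    fix i j assume "i < dim_row (1\<^sub>m (d + 1) :: 'a mat)" "j < dim_col (1\<^sub>m (d + 1) :: 'a mat)"
    then have ij: "i \<le> d" "j \<le> d" by auto
    then have "(Q * P) $$ (i, j) = (\<Sum>k<Suc d. (if i + k = d then inverse (w i) else 0) * (if k + j = d then w j else 0))"
      by (simp add: P_def Q_def scalar_prod_def lessThan_atLeast0)
    also have "\<dots> = (\<Sum>k<Suc d. if k = d - i then (if i = j then 1 else 0) else 0)"
      using ij w_nz by (intro sum.cong) auto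
    finally show "(Q * P) $$ (i, j) = 1\<^sub>m (d + 1) $$ (i, j)" using ij by (auto simp del: sum.lessThan_Suc)
  qed (simp_all add: P_def Q_def)
  have "similar_mat_wit (sl2_mat d a b e c) (sl2_mat d b a (- e) c) P Q" for a b e c
  proof (rule similar_mat_wit_of_intertwining[OF mat_mult_left_right_inverse[OF Q P QP] QP _ _ _ P Q])
    show "sl2_mat d a b e c * P = P * sl2_mat d b a (- e) c" (is "?L = ?R")
    proof (rule eq_matI)
      fix i j assume "i < dim_row ?R" "j < dim_col ?R"
      then have ij: "i \<le> d" "j \<le> d" by (auto simp: P_def)
      have "?L $$ (i, j) = (if i + j = Suc d then a * w j else 0)
         + (if i + j = d then (c + e * (of_nat i - of_nat j)) * w j else 0)
         + (if Suc (i + j) = d then b * w (Suc j) else 0)"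
        using ij by (subst sl2_mat_times_index[OF P])
          (auto simp: P_def w_Suc algebra_simps split: nat.split)
      moreover have "?R $$ (i, j) = (if i + j = Suc d then a * w j else 0)
         + (if i + j = d then (c + e * (of_nat i - of_nat j)) * w j else 0)
         + (if Suc (i + j) = d then b * w (Suc j) else 0)"
        using ij by (subst times_sl2_mat_index[OF P])
          (auto simp: P_def w_Suc algebra_simps split: nat.split)
      ultimately show "?L $$ (i, j) = ?R $$ (i, j)" by simp
    qed (auto simp: P_def)
  qed (rule sl2_mat_carrier)+
  then show thesis by (rule that)
qed

section \<open>Rigidity of a conjugation that fixes a diagonal matrix\<close>

lemma dim_mat_diag [simp]: "dim_row (mat_diag n f) = n" "dim_col (mat_diag n f) = n"
  by (simp_all add: mat_diag_def)

text \<open>\<open>R\<close> commutes with a diagonal matrix with distinct entries and is therefore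
  diagonal. The subdiagonal entries 1 on both sides make it scalar, so conjugation by it is
  trivial.\<close>

lemma similar_mat_wit_diag_self:
  fixes A A' :: "'a::field mat"
  assumes sim: "similar_mat_wit A A' R R'" "similar_mat_wit (mat_diag n \<theta>) (mat_diag n \<theta>) R R'"
    and inj: "inj_on \<theta> {..<n}" and A: "A \<in> carrier_mat n n"
    and sub: "\<And>i. Suc i < n \<Longrightarrow> A $$ (Suc i, i) = 1" "\<And>i. Suc i < n \<Longrightarrow> A' $$ (Suc i, i) = 1"
  shows "A = A'"
proof -
  note wA = similar_mat_witD2[OF A sim(1)] and wD = similar_mat_witD2[OF mat_diag_dim sim(2)]
  have "mat_diag n \<theta> * R = R * mat_diag n \<theta> * (R' * R)"
    using wD by (smt (verit) assoc_mult_mat mult_carrier_mat)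
  then have DR: "mat_diag n \<theta> * R = R * mat_diag n \<theta>" using wD by simp
  have "A * R = R * A' * (R' * R)"
    using wA by (smt (verit) assoc_mult_mat mult_carrier_mat)
  then have AR: "A * R = R * A'" using wA by simp
  have offdiag: "R $$ (i, j) = 0" if "i < n" "j < n" "i \<noteq> j" for i j
  proof -
    have "(mat_diag n \<theta> * R) $$ (i, j) = (R * mat_diag n \<theta>) $$ (i, j)" by (simp only: DR)
    then have "(\<theta> i - \<theta> j) * R $$ (i, j) = 0"
      using that wA(6) by (simp add: mat_diag_mult_left mat_diag_mult_right algebra_simps)
    then show ?thesis using inj that by (auto dest: inj_onD)
  qed
  define r where "r i = R $$ (i, i)" for i
  have R: "R = mat_diag n r"
    using wA(6) offdiag by (intro eq_matI) (auto simp: mat_diag_def r_def)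
  have entries: "A $$ (i, j) * r j = r i * A' $$ (i, j)" if "i < n" "j < n" for i j
  proof -
    have "(A * R) $$ (i, j) = (R * A') $$ (i, j)" by (simp only: AR)
    then show ?thesis
      unfolding R using that wA(4,5) by (simp add: mat_diag_mult_left mat_diag_mult_right)
  qed
  \<comment> \<open>The entry \<open>(Suc i, i)\<close> of the intertwining relation links
    neighbouring diagonal entries of \<open>R\<close>.\<close>
  have r_const: "r i = r 0" if "i < n" for i
    using that
  proof (induction i)
    case (Suc i)
    then show ?case using entries[of "Suc i" i] sub by simp
  qed simp
  have r_nz: "r i \<noteq> 0" if "i < n" for i
  proof
    assume "r i = 0"
    have "(R * R') $$ (i, i) = r i * R' $$ (i, i)"
      unfolding R using that wA(7) by (simp add: mat_diag_mult_left)
    then show False using wA(1) that \<open>r i = 0\<close> by simp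
  qed
  show ?thesis
  proof (rule eq_matI)
    fix i j assume "i < dim_row A'" "j < dim_col A'"
    then have ij: "i < n" "j < n" using wA(5) by auto
    then have "r 0 * A $$ (i, j) = r 0 * A' $$ (i, j)"
      using entries[of i j] r_const[of i] r_const[of j] by (simp add: mult.commute)
    then show "A $$ (i, j) = A' $$ (i, j)" using r_nz[of 0] ij by simp
  qed (use wA in auto)
qed

section \<open>Eigenvalues and standard orderings\<close>

lemma eigenvalues_mat_diag:
  "{t. eigenvalue (mat_diag n \<theta> :: 'a::field mat) t} = \<theta> ` {..<n}"
proof -
  have ut: "upper_triangular (mat_diag n \<theta>)"
    by (rule upper_triangularI) (simp add: mat_diag_def)
  have "diag_mat (mat_diag n \<theta>) = map \<theta> [0..<n]"
    by (simp add: diag_mat_def mat_diag_def)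
  then have "poly (char_poly (mat_diag n \<theta>)) t = 0 \<longleftrightarrow> t \<in> \<theta> ` {..<n}" for t
    unfolding char_poly_upper_triangular[OF mat_diag_dim ut]
    by (auto simp: poly_prod_list prod_list_zero_iff o_def)
  then show ?thesis
    by (auto simp: eigenvalue_root_char_poly[OF mat_diag_dim])
qed

lemma eigenvalue_similar:
  fixes A :: "'a::field mat"
  assumes "similar_mat_wit A B P Q"
  shows "eigenvalue A t \<longleftrightarrow> eigenvalue B t"
proof -
  have AB: "A \<in> carrier_mat (dim_row A) (dim_row A)" "B \<in> carrier_mat (dim_row A) (dim_row A)"
    using similar_mat_witD(4,5)[OF refl assms] by blast+
  have "char_poly A = char_poly B"
    using assms by (intro char_poly_similar) (auto simp: similar_mat_def)
  then show ?thesis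
    by (simp add: eigenvalue_root_char_poly[OF AB(1)] eigenvalue_root_char_poly[OF AB(2)])
qed

text \<open>The similarity already identifies the set of eigenvalues with the values of
  \<open>\<theta>\<close>, so injectivity completes the required bijection.\<close>

lemma standard_orderingI:
  fixes A :: "'a::field mat"
  assumes "inj_on \<theta> {0..d}" "similar_mat_wit A (mat_diag (d + 1) \<theta>) P Q"
    and "similar_mat_wit As M P Q" "irreducible_tridiagonal M"
  shows "standard_ordering d A As \<theta>"
proof -
  have "{t. eigenvalue A t} = \<theta> ` {..<d + 1}"
    using eigenvalue_similar[OF assms(2)] eigenvalues_mat_diag[of "d + 1" \<theta>] by simp
  also have "{..<d + 1} = {0..d}" by auto
  finally show ?thesis
    using assms by (auto simp: standard_ordering_def bij_betw_def)
qed

lemma standard_ordering_inj: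
  fixes A :: "'a::field mat"
  shows "standard_ordering d A As \<theta> \<Longrightarrow> inj_on \<theta> {0..d}"
  by (simp add: standard_ordering_def bij_betw_def)

section \<open>Primitive idempotents and flat part with respect to a diagonal matrix\<close>

lemma mat_diag_mult_vec:
  fixes f :: "nat \<Rightarrow> 'a::comm_semiring_1" and v :: "'a vec"
  assumes "v \<in> carrier_vec n" "i < n"
  shows "(mat_diag n f *\<^sub>v v) $ i = f i * v $ i"
proof -
  have "(mat_diag n f *\<^sub>v v) $ i = (\<Sum>j = 0..<n. (if i = j then f j else 0) * v $ j)"
    using assms by (auto simp: mat_diag_def scalar_prod_def)
  also have "\<dots> = (\<Sum>j = 0..<n. if j = i then f i * v $ i else 0)"
    by (intro sum.cong) auto
  finally show ?thesis using assms by simp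
qed

lemma eigenvector_mat_diagD:
  fixes \<theta> :: "nat \<Rightarrow> 'a::field" and v :: "'a vec"
  assumes "eigenvector (mat_diag n \<theta>) v s"
  shows "v \<in> carrier_vec n" "i < n \<Longrightarrow> \<theta> i \<noteq> s \<Longrightarrow> v $ i = 0"
proof -
  show v: "v \<in> carrier_vec n" using assms by (simp add: eigenvector_def)
  assume i: "i < n" "\<theta> i \<noteq> s"
  have "mat_diag n \<theta> *\<^sub>v v = s \<cdot>\<^sub>v v" using assms by (simp add: eigenvector_def)
  then have "\<theta> i * v $ i = s * v $ i"
    using mat_diag_mult_vec[OF v i(1), of \<theta>] v i(1) by (metis carrier_vecD index_smult_vec(1))
  then show "v $ i = 0" using i(2) by (auto simp: mult_cancel_right)
qed

lemma eigenvector_mat_diag_unit_vec: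
  fixes \<theta> :: "nat \<Rightarrow> 'a::field"
  assumes "j < n"
  shows "eigenvector (mat_diag n \<theta>) (unit_vec n j) (\<theta> j)"
proof -
  have "mat_diag n \<theta> *\<^sub>v unit_vec n j = \<theta> j \<cdot>\<^sub>v unit_vec n j"
  proof (rule eq_vecI)
    fix i assume "i < dim_vec (\<theta> j \<cdot>\<^sub>v unit_vec n j)"
    then have "i < n" by simp
    then show "(mat_diag n \<theta> *\<^sub>v unit_vec n j) $ i = (\<theta> j \<cdot>\<^sub>v unit_vec n j) $ i"
      using assms by (subst mat_diag_mult_vec) auto
  qed simp
  then show ?thesis using assms by (simp add: eigenvector_def)
qed

text \<open>Distinct diagonal entries make every eigenspace a coordinate line, so the projection is
  a diagonal matrix unit.\<close>

lemma primitive_idempotent_mat_diag: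
  fixes \<theta> :: "nat \<Rightarrow> 'a::field"
  assumes inj: "inj_on \<theta> {..<n}" and k: "k < n"
  shows "primitive_idempotent (mat_diag n \<theta>) (\<theta> k) = mat_diag n (\<lambda>i. if i = k then 1 else 0)"
    (is "_ = ?E")
  unfolding primitive_idempotent_def
proof (rule the_equality, intro conjI allI impI)
  show "?E \<in> carrier_mat (dim_row (mat_diag n \<theta>)) (dim_row (mat_diag n \<theta>))"
    by simp
  show "?E *\<^sub>v v = v" if v: "eigenvector (mat_diag n \<theta>) v (\<theta> k)" for v
  proof (rule eq_vecI)
    fix i assume "i < dim_vec v"
    then have "i < n" using eigenvector_mat_diagD(1)[OF v] by simp
    moreover have "v $ i = 0" if "i \<noteq> k"
      using eigenvector_mat_diagD(2)[OF v \<open>i < n\<close>] inj k \<open>i < n\<close> that by (auto dest: inj_onD)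
    ultimately show "(?E *\<^sub>v v) $ i = v $ i"
      by (subst mat_diag_mult_vec[OF eigenvector_mat_diagD(1)[OF v]]) auto
  qed (use eigenvector_mat_diagD(1)[OF v] in simp)
  show "?E *\<^sub>v v = 0\<^sub>v (dim_row (mat_diag n \<theta>))"
    if v: "s \<noteq> \<theta> k \<and> eigenvector (mat_diag n \<theta>) v s" for v s
  proof (rule eq_vecI)
    fix i assume "i < dim_vec (0\<^sub>v (dim_row (mat_diag n \<theta>)) :: 'a vec)"
    then have "i < n" by simp
    then show "(?E *\<^sub>v v) $ i = 0\<^sub>v (dim_row (mat_diag n \<theta>)) $ i"
      using eigenvector_mat_diagD[of n \<theta> v s] v k
      by (subst mat_diag_mult_vec[of v]) auto
  qed simp
  \<comment> \<open>Unit vectors are eigenvectors, so the prescribed action determines every column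
    of a candidate.\<close>
  fix E :: "'a mat"
  assume E: "E \<in> carrier_mat (dim_row (mat_diag n \<theta>)) (dim_row (mat_diag n \<theta>)) \<and>
    (\<forall>v. eigenvector (mat_diag n \<theta>) v (\<theta> k) \<longrightarrow> E *\<^sub>v v = v) \<and>
    (\<forall>v s. s \<noteq> \<theta> k \<and> eigenvector (mat_diag n \<theta>) v s \<longrightarrow> E *\<^sub>v v = 0\<^sub>v (dim_row (mat_diag n \<theta>)))"
  then have Ec: "E \<in> carrier_mat n n" by simp
  show "E = ?E"
  proof (rule eq_matI)
    fix i j assume "i < dim_row ?E" "j < dim_col ?E"
    then have ij: "i < n" "j < n" by (auto simp: mat_diag_def)
    have "E *\<^sub>v unit_vec n j = (if j = k then unit_vec n j else 0\<^sub>v n)"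
      using E eigenvector_mat_diag_unit_vec[OF ij(2), of \<theta>] inj_onD[OF inj, of j k] k ij(2)
      by (cases "j = k") auto
    moreover have "E $$ (i, j) = (E *\<^sub>v unit_vec n j) $ i"
      using Ec ij by simp
    ultimately show "E $$ (i, j) = ?E $$ (i, j)"
      using ij by (auto simp: mat_diag_def)
  qed (use Ec in \<open>auto simp: mat_diag_def\<close>)
qed

text \<open>Multiplying by the \<open>k\<close>-th matrix unit on both sides keeps only the entry
  \<open>(k, k)\<close>. Hence subtracting the flat part clears the diagonal of \<open>A\<close> and
  leaves all other entries unchanged.\<close>

lemma flat_part_mat_diag:
  fixes A :: "'a::field mat"
  assumes inj: "inj_on \<theta> {..<n}" and A: "A \<in> carrier_mat n n"
  shows "flat_part A (mat_diag n \<theta>) = mat_diag n (\<lambda>i. A $$ (i, i))"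
proof (rule eq_matI)
  fix i j
  assume "i < dim_row (mat_diag n (\<lambda>i. A $$ (i, i)))" "j < dim_col (mat_diag n (\<lambda>i. A $$ (i, i)))"
  then have ij: "i < n" "j < n" by (auto simp: mat_diag_def)
  have "flat_part A (mat_diag n \<theta>) $$ (i, j) = (\<Sum>k<n.
      (primitive_idempotent (mat_diag n \<theta>) (\<theta> k) * A * primitive_idempotent (mat_diag n \<theta>) (\<theta> k)) $$ (i, j))"
    using A ij by (simp add: flat_part_def eigenvalues_mat_diag sum.reindex[OF inj])
  also have "\<dots> = (\<Sum>k<n. if k = i then (if i = j then A $$ (i, i) else 0) else 0)"
  proof (intro sum.cong refl)
    fix k assume "k \<in> {..<n}"
    then show "(primitive_idempotent (mat_diag n \<theta>) (\<theta> k) * A * primitive_idempotent (mat_diag n \<theta>) (\<theta> k)) $$ (i, j)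
        = (if k = i then (if i = j then A $$ (i, i) else 0) else 0)"
      using A ij by (simp add: primitive_idempotent_mat_diag[OF inj] mat_diag_mult_left[OF A]
          mat_diag_mult_right[of _ n])
  qed
  finally show "flat_part A (mat_diag n \<theta>) $$ (i, j) = mat_diag n (\<lambda>i. A $$ (i, i)) $$ (i, j)"
    using ij by (simp add: mat_diag_def)
qed (use A in \<open>auto simp: flat_part_def mat_diag_def\<close>)

section \<open>Arithmetic progressions of eigenvalues; diagonal and bidiagonal forms inside the
  span\<close>

lemma irreducible_tridiagonal_sl2_mat:
  assumes nz: "\<And>i. 1 \<le> i \<Longrightarrow> i \<le> d \<Longrightarrow> of_nat i \<noteq> (0 :: 'a::field)"
    and "a \<noteq> 0" "b \<noteq> 0"
  shows "irreducible_tridiagonal (sl2_mat d a b e (c :: 'a))"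
proof -
  have "of_nat (Suc i) * (of_nat d - of_nat i) \<noteq> (0 :: 'a)" if "i < d" for i
    using nz[of "Suc i"] nz[of "d - i"] that by (simp add: of_nat_diff)
  then show ?thesis
    using assms(2,3) unfolding irreducible_tridiagonal_def tridiagonal_def
    by (auto simp: sl2_mat_def simp del: of_nat_Suc)
qed

lemma inj_on_affine_of_nat:
  assumes nz: "\<And>i. 1 \<le> i \<Longrightarrow> i \<le> d \<Longrightarrow> of_nat i \<noteq> (0 :: 'a::field)" and "m \<noteq> 0"
  shows "inj_on (\<lambda>i. c + m * (of_nat i - r :: 'a)) {0..d}"
proof (rule linorder_inj_onI)
  fix i j assume "i < j" "i \<in> {0..d}" "j \<in> {0..d}"
  then have "of_nat j \<noteq> (of_nat i :: 'a)"
    using nz[of "j - i"] by (simp add: of_nat_diff)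
  then show "c + m * (of_nat i - r) \<noteq> c + m * (of_nat j - r)" using \<open>m \<noteq> 0\<close> by auto
qed auto

text \<open>\<open>\<theta> i - \<theta> 0\<close> equals \<open>m * of_nat i\<close>. Distinct
  eigenvalues in arithmetic progression thus force the characteristic to be 0 or to exceed
  \<open>d\<close>.\<close>

lemma of_nat_nonzero_if_inj_on_affine:
  assumes "inj_on \<theta> {0..d}" "\<And>i. i \<le> d \<Longrightarrow> \<theta> i = c + m * (of_nat i - r :: 'a::field)"
    and "1 \<le> i" "i \<le> d"
  shows "of_nat i \<noteq> (0 :: 'a)" "m \<noteq> 0"
proof -
  have "\<theta> i \<noteq> \<theta> 0" using inj_onD[OF assms(1), of i 0] assms(3,4) by auto
  then show "of_nat i \<noteq> (0 :: 'a)" "m \<noteq> 0" using assms(2)[of i] assms(2)[of 0] assms(4) by auto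
qed

text \<open>Centring at \<open>d / 2\<close> makes the diagonal \<open>\<delta>\<close> plus
  \<open>\<mu> / 2\<close> times the diagonal of H.\<close>

lemma lower_bidiagonal_sl2_mat:
  assumes "(2 :: 'a::field) \<noteq> 0" "\<And>i. i \<le> d \<Longrightarrow> \<theta> i = \<delta> + \<mu> * (of_nat i - of_nat d / 2 :: 'a)"
  shows "lower_bidiagonal d \<theta> = sl2_mat d 1 0 (\<mu> / 2) \<delta>"
  using assms by (intro eq_matI) (auto simp: lower_bidiagonal_def sl2_mat_def field_simps)

lemma upper_bidiagonal_sl2_mat:
  assumes "(2 :: 'a::field) \<noteq> 0" "\<And>i. i \<le> d \<Longrightarrow> \<theta>s i = \<delta>s + \<mu>s * (of_nat i - of_nat d / 2 :: 'a)"
    and "\<And>i. 1 \<le> i \<Longrightarrow> i \<le> d \<Longrightarrow> \<phi> i = of_nat i * of_nat (d - i + 1) * c"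
  shows "upper_bidiagonal d \<theta>s \<phi> = sl2_mat d 0 c (\<mu>s / 2) \<delta>s"
proof (rule eq_matI)
  fix i j assume "i < dim_row (sl2_mat d 0 c (\<mu>s / 2) \<delta>s)" "j < dim_col (sl2_mat d 0 c (\<mu>s / 2) \<delta>s)"
  then have ij: "i \<le> d" "j \<le> d" by auto
  have "\<phi> j = c * (of_nat j * (of_nat d - of_nat i))" if "j = Suc i"
    using assms(3)[of j] ij that by (simp add: of_nat_diff mult_ac)
  then show "upper_bidiagonal d \<theta>s \<phi> $$ (i, j) = sl2_mat d 0 c (\<mu>s / 2) \<delta>s $$ (i, j)"
    using assms(1,2) ij by (auto simp: upper_bidiagonal_def sl2_mat_def field_simps)
qed (simp_all add: upper_bidiagonal_def)

lemma mat_diag_cong: "(\<And>i. i < n \<Longrightarrow> f i = g i) \<Longrightarrow> mat_diag n f = mat_diag n g"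
  by (rule eq_matI) (auto simp: mat_diag_def)

lemma mat_diag_affine_sl2_mat:
  assumes "(2 :: 'a::field) \<noteq> 0" "\<And>i. i \<le> d \<Longrightarrow> \<theta> i = \<delta> + \<mu> * (of_nat i - of_nat d / 2 :: 'a)"
  shows "mat_diag (d + 1) \<theta> = sl2_mat d 0 0 (\<mu> / 2) \<delta>"
  unfolding sl2_mat_diag using assms by (intro mat_diag_cong) (auto simp: field_simps)

section \<open>Split forms and the normalized TD/D form\<close>

lemma split_form_exists:
  fixes \<mu> \<mu>s \<tau> \<delta> \<delta>s :: "'a::field"
  assumes "(2 :: 'a) \<noteq> 0" "\<mu>s \<noteq> 0"
  defines "e \<equiv> \<tau> / \<mu>s"
  obtains P Q where
    "similar_mat_wit (sl2_mat d 1 (\<mu>\<^sup>2 / 4 - e\<^sup>2) e \<delta>) (sl2_mat d 1 0 (\<mu> / 2) \<delta>) P Q"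
    "similar_mat_wit (sl2_mat d 0 0 (\<mu>s / 2) \<delta>s) (sl2_mat d 0 (\<tau> - \<mu> * \<mu>s / 2) (\<mu>s / 2) \<delta>s) P Q"
proof -
  \<comment> \<open>The new coefficient of H must be \<open>e + t = \<mu> / 2\<close>. The
    superdiagonal coefficient then becomes \<open>\<mu>\<^sup>2 / 4 - (e + t)\<^sup>2\<close>, which
    is 0, and the diagonal matrix acquires the coefficient
    \<open>- t * \<mu>s = \<tau> - \<mu> * \<mu>s / 2\<close>.\<close>
  define t where "t = \<mu> / 2 - e"
  have "\<mu>\<^sup>2 / 4 = (\<mu> / 2)\<^sup>2" by (simp add: power_divide)
  then have eqs: "\<mu>\<^sup>2 / 4 - e\<^sup>2 - 2 * t * e - t\<^sup>2 * 1 = 0" "e + t * 1 = \<mu> / 2"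
    by (simp_all add: t_def algebra_simps power2_eq_square)
  have "t * \<mu>s = \<mu> * \<mu>s / 2 - \<tau>"
    using assms(2) by (simp add: t_def e_def left_diff_distrib)
  then have eqs': "0 - 2 * t * (\<mu>s / 2) - t\<^sup>2 * 0 = \<tau> - \<mu> * \<mu>s / 2" "\<mu>s / 2 + t * 0 = \<mu>s / 2"
    using assms(1) by simp_all
  obtain P Q where PQ:
    "\<And>a b e c. similar_mat_wit (sl2_mat d a b e c) (sl2_mat d a (b - 2 * t * e - t\<^sup>2 * a) (e + t * a) c) P Q"
    using sl2_mat_exp_conjugation by blast
  show thesis
    using that PQ[of 1 "\<mu>\<^sup>2 / 4 - e\<^sup>2" e \<delta>] PQ[of 0 0 "\<mu>s / 2" \<delta>s] unfolding eqs eqs' by blast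
qed

text \<open>The split form and the normalized TD/D form determine each other: moving the split form
  back by \<open>split_form_exists\<close> leaves a conjugation that fixes \<open>A\<^sup>*\<close>, hence a diagonal one, and the
  subdiagonal entries force it to be scalar.\<close>

lemma normalized_form_of_split_form:
  fixes A :: "'a::field mat" and \<tau> :: 'a
  assumes two: "(2 :: 'a) \<noteq> 0" and inj: "inj_on \<theta>s {0..d}" and ms: "\<mu>s \<noteq> 0"
    and A: "A \<in> carrier_mat (d + 1) (d + 1)" "\<And>i. i < d \<Longrightarrow> A $$ (Suc i, i) = 1"
    and sim: "similar_mat_wit A (lower_bidiagonal d \<theta>) P Q"
      "similar_mat_wit (mat_diag (d + 1) \<theta>s) (upper_bidiagonal d \<theta>s \<phi>) P Q"
    and th: "\<And>i. i \<le> d \<Longrightarrow> \<theta> i = \<delta> + \<mu> * (of_nat i - of_nat d / 2)"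
    and ths: "\<And>i. i \<le> d \<Longrightarrow> \<theta>s i = \<delta>s + \<mu>s * (of_nat i - of_nat d / 2)"
    and phi: "\<And>i. 1 \<le> i \<Longrightarrow> i \<le> d \<Longrightarrow> \<phi> i = of_nat i * of_nat (d - i + 1) * (\<tau> - \<mu> * \<mu>s / 2)"
  shows "A = sl2_mat d 1 (\<mu>\<^sup>2 / 4 - (\<tau> / \<mu>s)\<^sup>2) (\<tau> / \<mu>s) \<delta>"
proof -
  obtain P' Q' where PQ':
    "similar_mat_wit (sl2_mat d 1 (\<mu>\<^sup>2 / 4 - (\<tau> / \<mu>s)\<^sup>2) (\<tau> / \<mu>s) \<delta>) (sl2_mat d 1 0 (\<mu> / 2) \<delta>) P' Q'"
    "similar_mat_wit (sl2_mat d 0 0 (\<mu>s / 2) \<delta>s) (sl2_mat d 0 (\<tau> - \<mu> * \<mu>s / 2) (\<mu>s / 2) \<delta>s) P' Q'"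
    using split_form_exists[OF two ms] by blast
  note D = mat_diag_affine_sl2_mat[OF two ths, simplified]
  have "similar_mat_wit A (sl2_mat d 1 (\<mu>\<^sup>2 / 4 - (\<tau> / \<mu>s)\<^sup>2) (\<tau> / \<mu>s) \<delta>) (P * Q') (P' * Q)"
    using similar_mat_wit_trans[OF sim(1) similar_mat_wit_sym] PQ'(1)
    by (simp add: lower_bidiagonal_sl2_mat[OF two th])
  moreover have "similar_mat_wit (mat_diag (d + 1) \<theta>s) (mat_diag (d + 1) \<theta>s) (P * Q') (P' * Q)"
    using similar_mat_wit_trans[OF sim(2) similar_mat_wit_sym] PQ'(2)
    by (simp add: upper_bidiagonal_sl2_mat[OF two ths phi] D)
  moreover have "{..<d + 1} = {0..d}" by auto
  ultimately show ?thesis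
    using A inj by (intro similar_mat_wit_diag_self) (auto simp: sl2_mat_def)
qed

section \<open>A Leonard pair with prescribed primary data\<close>

text \<open>The standard basis gives the first condition on a Leonard pair. The second comes from
  carrying the first split form further, to a basis that diagonalizes the tridiagonal
  matrix.\<close>

lemma sl2_mat_parameter_array:
  fixes \<delta> \<mu> \<delta>s \<mu>s \<tau> :: "'a::field"
  assumes two: "(2 :: 'a) \<noteq> 0" and nz: "\<And>i. 1 \<le> i \<Longrightarrow> i \<le> d \<Longrightarrow> of_nat i \<noteq> (0 :: 'a)"
    and mu: "\<mu> \<noteq> 0" "\<mu>s \<noteq> 0" and b: "\<mu>\<^sup>2 / 4 - (\<tau> / \<mu>s)\<^sup>2 \<noteq> 0"
    and th: "\<And>i. i \<le> d \<Longrightarrow> \<theta> i = \<delta> + \<mu> * (of_nat i - of_nat d / 2)"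
    and ths: "\<And>i. i \<le> d \<Longrightarrow> \<theta>s i = \<delta>s + \<mu>s * (of_nat i - of_nat d / 2)"
    and phi1: "\<And>i. 1 \<le> i \<Longrightarrow> i \<le> d \<Longrightarrow> \<phi>1 i = of_nat i * of_nat (d - i + 1) * (\<tau> - \<mu> * \<mu>s / 2)"
    and phi2: "\<And>i. 1 \<le> i \<Longrightarrow> i \<le> d \<Longrightarrow> \<phi>2 i = of_nat i * of_nat (d - i + 1) * (\<tau> + \<mu> * \<mu>s / 2)"
  shows "parameter_array d (sl2_mat d 1 (\<mu>\<^sup>2 / 4 - (\<tau> / \<mu>s)\<^sup>2) (\<tau> / \<mu>s) \<delta>) (mat_diag (d + 1) \<theta>s) \<theta> \<theta>s \<phi>1 \<phi>2"
    (is "parameter_array d ?A ?D \<theta> \<theta>s \<phi>1 \<phi>2")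
proof -
  have th_eq: "mat_diag (d + 1) \<theta> = sl2_mat d 0 0 (\<mu> / 2) \<delta>"
    and ths_eq: "?D = sl2_mat d 0 0 (\<mu>s / 2) \<delta>s"
    using mat_diag_affine_sl2_mat[OF two th] mat_diag_affine_sl2_mat[OF two ths] by simp_all
  have irr_A: "irreducible_tridiagonal ?A"
    using b by (intro irreducible_tridiagonal_sl2_mat nz) auto
  have inj: "inj_on \<theta> {0..d}" "inj_on \<theta>s {0..d}"
    using inj_on_affine_of_nat[OF nz mu(1), of d \<delta> "of_nat d / 2"]
      inj_on_affine_of_nat[OF nz mu(2), of d \<delta>s "of_nat d / 2"]
    by (auto simp: th ths inj_on_def)
  have four: "(4 :: 'a) \<noteq> 0" using two by (metis mult_2 mult_eq_0_iff numeral_Bit0)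
  define c where "c = \<tau> - \<mu> * \<mu>s / 2"
  define c' where "c' = \<tau> + \<mu> * \<mu>s / 2"
  \<comment> \<open>The superdiagonal coefficient factors through the two split coefficients, so
    neither of them can vanish.\<close>
  have "\<mu>\<^sup>2 / 4 - (\<tau> / \<mu>s)\<^sup>2 = - (c * c') / \<mu>s\<^sup>2"
    using two four mu by (simp add: c_def c'_def field_simps power2_eq_square)
  then have c: "c \<noteq> 0" "c' \<noteq> 0" using b by auto
  obtain P1 Q1 where PQ1: "similar_mat_wit ?A (sl2_mat d 1 0 (\<mu> / 2) \<delta>) P1 Q1"
    "similar_mat_wit (sl2_mat d 0 0 (\<mu>s / 2) \<delta>s) (sl2_mat d 0 c (\<mu>s / 2) \<delta>s) P1 Q1"
    unfolding c_def using split_form_exists[OF two mu(2)] by blast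
  \<comment> \<open>Replacing \<open>\<mu>\<close> by \<open>- \<mu>\<close> reverses the
    eigenvalues but keeps \<open>\<mu>\<^sup>2\<close>, so the same matrix also has the second split
    form.\<close>
  obtain P2 Q2 where PQ2: "similar_mat_wit ?A (sl2_mat d 1 0 (- \<mu> / 2) \<delta>) P2 Q2"
    "similar_mat_wit (sl2_mat d 0 0 (\<mu>s / 2) \<delta>s) (sl2_mat d 0 c' (\<mu>s / 2) \<delta>s) P2 Q2"
    using split_form_exists[OF two mu(2), of d "- \<mu>" \<tau> \<delta> \<delta>s] unfolding c'_def
    by (simp only: power2_minus mult_minus_left minus_divide_left[symmetric] diff_minus_eq_add) blast
  obtain W W' where W: "\<And>a b e c :: 'a. similar_mat_wit (sl2_mat d a b e c) (sl2_mat d b a (- e) c) W W'"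
    using sl2_mat_swap_conjugation[OF nz] by blast
  \<comment> \<open>Reversal turns the coefficients \<open>(1, 0, \<mu> / 2)\<close> of the split
    form into \<open>(0, 1, - \<mu> / 2)\<close>. This \<open>t\<close> lets exp(tE) remove the
    superdiagonal, and a second reversal restores the sign.\<close>
  define t where "t = - 1 / \<mu>"
  obtain E E' where E:
    "\<And>a b e c. similar_mat_wit (sl2_mat d a b e c) (sl2_mat d a (b - 2 * t * e - t\<^sup>2 * a) (e + t * a) c) E E'"
    using sl2_mat_exp_conjugation by blast
  \<comment> \<open>The same three conjugations take the other split matrix to the coefficients
    \<open>(a, c, e)\<close>. Irreducibility there needs \<open>a\<close> and \<open>c\<close>
    nonzero, and \<open>a\<close> is a multiple of \<open>c'\<close>.\<close>
  define a e where "a = 0 - 2 * t * (- (\<mu>s / 2)) - t\<^sup>2 * c" and "e = - (- (\<mu>s / 2) + t * c)"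
  have "a = - c' / \<mu>\<^sup>2"
    using two mu by (simp add: a_def t_def c_def c'_def field_simps power2_eq_square)
  then have a: "a \<noteq> 0" using c mu by simp
  have t: "1 - 2 * t * (- (\<mu> / 2)) - t\<^sup>2 * 0 = 0" "- (\<mu> / 2) + t * 0 = - (\<mu> / 2)"
    using two mu by (simp_all add: t_def)
  have diag_A: "similar_mat_wit ?A (mat_diag (d + 1) \<theta>) (P1 * (W * (E * W))) (W' * E' * W' * Q1)"
    using similar_mat_wit_trans[OF PQ1(1) similar_mat_wit_trans[OF W
        similar_mat_wit_trans[OF E[of 0 1 "- (\<mu> / 2)" \<delta>, unfolded t] W]]]
    by (simp only: minus_minus th_eq)
  have tridiag_D: "similar_mat_wit ?D (sl2_mat d a c e \<delta>s) (P1 * (W * (E * W))) (W' * E' * W' * Q1)"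
    unfolding ths_eq a_def e_def
    by (rule similar_mat_wit_trans[OF PQ1(2) similar_mat_wit_trans[OF W
        similar_mat_wit_trans[OF E W]]])
  have irr_D: "irreducible_tridiagonal (sl2_mat d a c e \<delta>s)"
    using a c by (intro irreducible_tridiagonal_sl2_mat nz) auto
  have carrier: "?A \<in> carrier_mat (d + 1) (d + 1)" "?D \<in> carrier_mat (d + 1) (d + 1)"
    by (rule sl2_mat_carrier mat_diag_dim)+
  have refl: "similar_mat_wit ?A ?A (1\<^sub>m (d + 1)) (1\<^sub>m (d + 1))"
    "similar_mat_wit ?D ?D (1\<^sub>m (d + 1)) (1\<^sub>m (d + 1))"
    by (rule similar_mat_wit_refl carrier)+
  have diag: "diagonal_mat (mat_diag (d + 1) f)" for f :: "nat \<Rightarrow> 'a"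
    by (auto simp: diagonal_mat_def mat_diag_def)
  have "leonard_pair d ?A ?D"
    unfolding leonard_pair_def using carrier refl irr_A diag diag_A tridiag_D irr_D by blast
  moreover have "standard_ordering d ?A ?D \<theta>"
    by (rule standard_orderingI[OF inj(1) diag_A tridiag_D irr_D])
  moreover have "standard_ordering d ?D ?A \<theta>s"
    by (rule standard_orderingI[OF inj(2) refl(2,1) irr_A])
  moreover have "lower_bidiagonal d (\<lambda>i. \<theta> (d - i)) = sl2_mat d 1 0 (- \<mu> / 2) \<delta>"
  proof (rule lower_bidiagonal_sl2_mat[OF two])
    fix i assume "i \<le> d"
    then show "\<theta> (d - i) = \<delta> + - \<mu> * (of_nat i - of_nat d / 2)"
      using two th[of "d - i"] by (simp add: of_nat_diff field_simps)
  qed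
  moreover have "lower_bidiagonal d \<theta> = sl2_mat d 1 0 (\<mu> / 2) \<delta>"
    by (rule lower_bidiagonal_sl2_mat[OF two th])
  moreover have "upper_bidiagonal d \<theta>s \<phi>1 = sl2_mat d 0 c (\<mu>s / 2) \<delta>s"
    unfolding c_def by (rule upper_bidiagonal_sl2_mat[OF two ths phi1])
  moreover have "upper_bidiagonal d \<theta>s \<phi>2 = sl2_mat d 0 c' (\<mu>s / 2) \<delta>s"
    unfolding c'_def by (rule upper_bidiagonal_sl2_mat[OF two ths phi2])
  ultimately show ?thesis
    unfolding parameter_array_def using PQ1 PQ2 ths_eq by metis
qed

section \<open>Difference conditions on eigenvalue sequences\<close>

text \<open>The second difference of \<open>f\<close> over 0, 1, 2 is
  \<open>- 2 * k\<close>.\<close>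

lemma quadratic_part_zero_if_equidistant:
  fixes f :: "nat \<Rightarrow> 'a::field"
  assumes "(2 :: 'a) \<noteq> 0" "2 \<le> d"
    and f: "\<And>i. i \<le> d \<Longrightarrow> f i = p + m * (of_nat i - r) + k * of_nat i * of_nat (d - i)"
    and diff: "\<And>i. i \<in> {1..d} \<Longrightarrow> f i - f (i - 1) = g"
  shows "k = 0"
proof -
  have f_val: "f 0 = p - m * r" "f 1 = p + m - m * r + k * (of_nat d - 1)"
    "f 2 = p + 2 * m - m * r + 2 * k * (of_nat d - 2)"
    using assms(2) f[of 0] f[of 1] f[of 2] by (simp_all add: of_nat_diff algebra_simps)
  have "2 * k = (f 1 - f 0) - (f 2 - f 1)"
    unfolding f_val by (simp add: algebra_simps)
  also have "\<dots> = 0"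
    using diff[of 1] diff[of 2] assms(2) by simp
  finally show ?thesis using assms(1) by simp
qed

text \<open>Three steps against one give the quotient 3, written \<open>2 + 1\<close> to match
  \<open>\<beta> + 1\<close> for type II.\<close>

lemma affine_difference_quotient:
  fixes f :: "nat \<Rightarrow> 'a::field"
  assumes "m \<noteq> 0" and f: "\<And>i. i \<le> d \<Longrightarrow> f i = c + m * (of_nat i - r)" and i: "i \<in> {2..d - 1}"
  shows "(f (i - 2) - f (i + 1)) / (f (i - 1) - f i) = 2 + 1"
proof -
  obtain k where k: "i = k + 2" "k + 3 \<le> d"
    using i by (intro that[of "i - 2"]) auto
  have diffs: "f k - f (k + 3) = (2 + 1) * - m" "f (k + 1) - f (k + 2) = - m"
    using k(2) by (simp_all only: f) (simp_all add: algebra_simps)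
  have "i - 2 = k" "i + 1 = k + 3" "i - 1 = k + 1" using k(1) by simp_all
  then have "(f (i - 2) - f (i + 1)) / (f (i - 1) - f i) = (2 + 1) * - m / - m"
    by (simp only: diffs k(1))
  then show ?thesis using \<open>m \<noteq> 0\<close> by simp
qed

section \<open>The near-bipartite expansion with prescribed primary data\<close>

theorem theorem27p3:
  fixes d :: nat
    and B As H A :: "'a::alg_closed_field mat"
    and \<theta>' \<theta>s \<phi>1' \<phi>2' x' :: "nat \<Rightarrow> 'a"
    and \<delta>' \<mu>' h' \<delta>s \<mu>s hs \<tau>' \<delta> \<mu> h \<tau> :: 'a
  assumes "CHAR('a) \<noteq> 2"
    and "d \<ge> 3"
    and "bipartite d B As"
    and "krawtchouk_type d B As"
    and "parameter_array d B As \<theta>' \<theta>s \<phi>1' \<phi>2'"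
    and "corresponding_primary_data d \<theta>' \<theta>s \<phi>1' \<phi>2' \<delta>' \<mu>' h' \<delta>s \<mu>s hs \<tau>'"
    and "normalized_TD_D_form d B As x' \<theta>s"
    and "H = mat_diag (d + 1) (\<lambda>i. 2 * of_nat i - of_nat d)"
    and "\<mu> \<noteq> 0"
    and "h = 0"
    and "4 * \<tau>\<^sup>2 = (\<mu>\<^sup>2 - \<mu>'\<^sup>2) * \<mu>s\<^sup>2"
  shows "near_bipartite_expansion d B As A \<and> primary_data d A As \<delta> \<mu> h \<delta>s \<mu>s hs \<tau>
    \<longleftrightarrow> A = B + (\<tau> / \<mu>s) \<cdot>\<^sub>m H + \<delta> \<cdot>\<^sub>m 1\<^sub>m (d + 1)"
proof -
  have "\<not> CHAR('a) dvd 2"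
    using assms(1) by (metis CHAR_not_1 prime_nat_iff two_is_prime_nat One_nat_def)
  then have two: "(2 :: 'a) \<noteq> 0"
    by (metis of_nat_eq_0_iff_char_dvd of_nat_numeral)
  then have four: "(4 :: 'a) \<noteq> 0" by (metis mult_2 mult_eq_0_iff numeral_Bit0)
  have As: "As = mat_diag (d + 1) \<theta>s"
    and B: "B = mat (d + 1) (d + 1) (\<lambda>(i, j). if i = Suc j then 1 else if j = Suc i then x' j else 0)"
    using assms(7) by (simp_all add: normalized_TD_D_form_def)
  have so: "standard_ordering d B As \<theta>'" "standard_ordering d As B \<theta>s"
    using assms(5) by (simp_all add: parameter_array_def)
  note inj' = standard_ordering_inj[OF so(1)] and injs = standard_ordering_inj[OF so(2)]
  note data = assms(6)[unfolded corresponding_primary_data_def]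
  \<comment> \<open>Krawtchouk type makes both eigenvalue sequences arithmetic progressions, so
    their quadratic coefficients vanish.\<close>
  have hs: "hs = 0" and h': "h' = 0"
  proof -
    obtain g g' where "\<And>i. i \<in> {1..d} \<Longrightarrow> \<theta>' i - \<theta>' (i - 1) = g'"
      "\<And>i. i \<in> {1..d} \<Longrightarrow> \<theta>s i - \<theta>s (i - 1) = g"
      using assms(4) so unfolding krawtchouk_type_def by metis
    moreover have "2 \<le> d" using assms(2) by simp
    ultimately show "hs = 0" "h' = 0"
      using quadratic_part_zero_if_equidistant[OF two, of d \<theta>s \<delta>s \<mu>s "of_nat d / 2" hs g]
        quadratic_part_zero_if_equidistant[OF two, of d \<theta>' \<delta>' \<mu>' "of_nat d / 2" h' g']
        data(1) atLeastAtMost_iff le0 by blast+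
  qed
  have th': "\<theta>' i = \<delta>' + \<mu>' * (of_nat i - of_nat d / 2)"
    and ths: "\<theta>s i = \<delta>s + \<mu>s * (of_nat i - of_nat d / 2)" if "i \<le> d" for i
    using data that by (auto simp: hs h')
  have phi1': "\<phi>1' i = of_nat i * of_nat (d - i + 1) * (\<tau>' - \<mu>' * \<mu>s / 2)" if "1 \<le> i" "i \<le> d" for i
    using data that by (auto simp: hs h')
  have nz: "of_nat i \<noteq> (0 :: 'a)" if "1 \<le> i" "i \<le> d" for i
    using of_nat_nonzero_if_inj_on_affine(1)[OF injs ths that] .
  have ms: "\<mu>s \<noteq> 0" and m': "\<mu>' \<noteq> 0"
    using of_nat_nonzero_if_inj_on_affine(2)[OF injs ths, of 1]
      of_nat_nonzero_if_inj_on_affine(2)[OF inj' th', of 1] assms(2) by auto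
  obtain P Q where PQ: "similar_mat_wit B (lower_bidiagonal d \<theta>') P Q"
    "similar_mat_wit (mat_diag (d + 1) \<theta>s) (upper_bidiagonal d \<theta>s \<phi>1') P Q"
    using assms(5) unfolding parameter_array_def As by blast
  \<comment> \<open>Uniqueness of the normalized form is applied first to \<open>B\<close> itself,
    with its own parameter array.\<close>
  have B_sl2: "B = sl2_mat d 1 (\<mu>'\<^sup>2 / 4 - (\<tau>' / \<mu>s)\<^sup>2) (\<tau>' / \<mu>s) \<delta>'"
    by (rule normalized_form_of_split_form[OF two injs ms _ _ PQ th' ths phi1']) (auto simp: B)
  \<comment> \<open>The diagonal of \<open>B\<close> is zero. Its entries at 0 and 1 differ by twice
    the coefficient of H, so \<open>\<tau>'\<close> vanishes, and then
    \<open>\<delta>'\<close>.\<close>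
  have B_diag: "\<delta>' + \<tau>' / \<mu>s * (2 * of_nat i - of_nat d) = 0" if "i \<le> d" for i
    using arg_cong[OF B_sl2, of "\<lambda>M. M $$ (i, i)"] that by (simp add: B sl2_mat_def)
  have "2 * (\<tau>' / \<mu>s) = 0"
    using B_diag[of 0] B_diag[of 1] assms(2) by (simp add: algebra_simps)
  then have "\<tau>' = 0" using two ms by simp
  then have "\<delta>' = 0" using B_diag[of 0] by simp
  define b where "b = \<mu>'\<^sup>2 / 4"
  have B_eq: "B = sl2_mat d 1 b 0 0"
    using B_sl2 \<open>\<tau>' = 0\<close> \<open>\<delta>' = 0\<close> by (simp add: b_def)
  have b_nz: "b \<noteq> 0" using m' four by (simp add: b_def)
  \<comment> \<open>Divided by \<open>4 * \<mu>s\<^sup>2\<close>, the condition on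
    \<open>\<tau>\<close> says that the new data lead to the same superdiagonal coefficient
    \<open>b\<close> as \<open>B\<close>.\<close>
  have "\<tau>\<^sup>2 = (\<mu>\<^sup>2 - \<mu>'\<^sup>2) * \<mu>s\<^sup>2 / 4"
    using assms(11) four by (metis nonzero_mult_div_cancel_left)
  then have "(\<tau> / \<mu>s)\<^sup>2 = (\<mu>\<^sup>2 - \<mu>'\<^sup>2) / 4"
    using ms by (simp add: power_divide)
  then have b: "\<mu>\<^sup>2 / 4 - (\<tau> / \<mu>s)\<^sup>2 = b"
    by (simp add: b_def diff_divide_distrib)
  define A0 where "A0 = sl2_mat d 1 b (\<tau> / \<mu>s) \<delta>"
  have A0_eq: "B + (\<tau> / \<mu>s) \<cdot>\<^sub>m H + \<delta> \<cdot>\<^sub>m 1\<^sub>m (d + 1) = A0"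
    unfolding B_eq A0_def assms(8)
    by (rule eq_matI) (auto simp: sl2_mat_def mat_diag_def)
  have injs': "inj_on \<theta>s {..<d + 1}"
    using injs by (simp add: atLeast0AtMost lessThan_Suc_atMost)
  have "A = A0" if nbe: "near_bipartite_expansion d B As A" and pdata: "primary_data d A As \<delta> \<mu> h \<delta>s \<mu>s hs \<tau>"
  proof -
    obtain \<theta> \<theta>s' \<phi>1 \<phi>2 where pa: "parameter_array d A As \<theta> \<theta>s' \<phi>1 \<phi>2"
      and pd: "corresponding_primary_data d \<theta> \<theta>s' \<phi>1 \<phi>2 \<delta> \<mu> h \<delta>s \<mu>s hs \<tau>"
      using pdata unfolding primary_data_def by blast
    note pd = pd[unfolded corresponding_primary_data_def assms(10) hs]
    have A: "A \<in> carrier_mat (d + 1) (d + 1)"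
      using pa by (simp add: parameter_array_def leonard_pair_def)
    \<comment> \<open>\<open>A\<close> and \<open>B\<close> differ only on the diagonal, so
      \<open>A\<close> inherits the subdiagonal entries 1 that uniqueness requires.\<close>
    have flat: "A - mat_diag (d + 1) (\<lambda>i. A $$ (i, i)) = B"
      using nbe flat_part_mat_diag[OF injs' A] by (simp add: near_bipartite_expansion_def As)
    have sub: "A $$ (Suc i, i) = 1" if "i < d" for i
      using arg_cong[OF flat, of "\<lambda>M. M $$ (Suc i, i)"] that A by (simp add: B mat_diag_def)
    \<comment> \<open>The starred primary data are shared with \<open>B\<close>, which fixes the
      order of the dual eigenvalues.\<close>
    have eqs: "\<theta>s' i = \<theta>s i" if "i \<le> d" for i using pd ths that by auto
    obtain P Q where "similar_mat_wit A (lower_bidiagonal d \<theta>) P Q"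
      "similar_mat_wit As (upper_bidiagonal d \<theta>s' \<phi>1) P Q"
      using pa unfolding parameter_array_def by blast
    moreover have "upper_bidiagonal d \<theta>s' \<phi>1 = upper_bidiagonal d \<theta>s \<phi>1"
      by (rule eq_matI) (auto simp: upper_bidiagonal_def eqs)
    ultimately show ?thesis
      unfolding A0_def b[symmetric]
      by (intro normalized_form_of_split_form[OF two injs ms A sub, of \<theta> P Q \<phi>1 \<delta> \<mu> \<delta>s \<tau>])
        (use pd ths in \<open>auto simp: As\<close>)
  qed
  \<comment> \<open>Conversely, \<open>A0\<close> realizes the data: \<open>b \<noteq> 0\<close>
    makes it irreducible, and clearing its diagonal returns \<open>B\<close>.\<close>
  moreover have "near_bipartite_expansion d B As A0 \<and> primary_data d A0 As \<delta> \<mu> h \<delta>s \<mu>s hs \<tau>"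
  proof -
    define \<theta> where "\<theta> i = \<delta> + \<mu> * (of_nat i - of_nat d / 2)" for i
    define \<phi>1 where "\<phi>1 i = of_nat i * of_nat (d - i + 1) * (\<tau> - \<mu> * \<mu>s / 2)" for i
    define \<phi>2 where "\<phi>2 i = of_nat i * of_nat (d - i + 1) * (\<tau> + \<mu> * \<mu>s / 2)" for i
    have A0: "A0 \<in> carrier_mat (d + 1) (d + 1)" unfolding A0_def by (rule sl2_mat_carrier)
    have pa: "parameter_array d A0 As \<theta> \<theta>s \<phi>1 \<phi>2"
      unfolding A0_def b[symmetric] As
      by (rule sl2_mat_parameter_array[OF two nz assms(9) ms])
        (use b b_nz ths in \<open>auto simp: \<theta>_def \<phi>1_def \<phi>2_def\<close>)
    have "fundamental_parameter d A0 As 2"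
      unfolding fundamental_parameter_def
    proof (intro exI conjI ballI)
      show "standard_ordering d A0 As \<theta>" "standard_ordering d As A0 \<theta>s"
        using pa by (simp_all add: parameter_array_def)
      fix i assume i: "i \<in> {2..d - 1}"
      show "(\<theta> (i - 2) - \<theta> (i + 1)) / (\<theta> (i - 1) - \<theta> i) = 2 + 1"
        by (rule affine_difference_quotient[OF assms(9) \<theta>_def i])
      show "(\<theta>s (i - 2) - \<theta>s (i + 1)) / (\<theta>s (i - 1) - \<theta>s i) = 2 + 1"
        by (rule affine_difference_quotient[OF ms ths i])
    qed
    then have "type_II d A0 As"
      using assms(2) pa by (simp add: type_II_def parameter_array_def)
    moreover have "corresponding_primary_data d \<theta> \<theta>s \<phi>1 \<phi>2 \<delta> \<mu> h \<delta>s \<mu>s hs \<tau>"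
      unfolding corresponding_primary_data_def assms(10) hs
      by (auto simp: \<theta>_def \<phi>1_def \<phi>2_def ths)
    moreover have "A0 - flat_part A0 As = B"
      unfolding As flat_part_mat_diag[OF injs' A0]
      by (rule eq_matI) (auto simp: A0_def B_eq sl2_mat_def mat_diag_def)
    ultimately show ?thesis
      using pa assms(3)
      unfolding primary_data_def near_bipartite_expansion_def near_bipartite_def
        parameter_array_def bipartite_def by metis
  qed
  ultimately show ?thesis unfolding A0_eq by blast
qed

end
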